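(* Let $p,q\in\mathcal{G}$ be the probability mass functions of the random variables $X\sim p$ and $Y\sim q$, with supports $S_p=\{0,\ldots,M\}$ and $S_q=\{0,\ldots,N\}$, $0\le N\le M\le\infty$ (so that $S_q\subseteq S_p$), and suppose that $\mathcal{F}^{-}(p)\cap\mathcal{F}^{-}(q)\neq\emptyset$. Let $\mathcal{H}$ be a class of functions $l:\mathbb{Z}\to\mathbb{R}$ for which ${\rm E}_p[l(X)]$ and ${\rm E}_q[l(Y)]$ exist, and let $$d_{\mathcal{H}}(X,Y)=\sup_{l\in\mathcal{H}}\left|{\rm E}_q[l(Y)]-{\rm E}_p[l(X)]\right|.$$ For $l\in\mathcal{H}$ let $f_l^{p,-}:\mathbb{Z}\to\mathbb{R}$ be given by $$f_l^{p,-}(x)=\frac{1}{p(x)}\sum_{k=0}^{x}\bigl(l(k)-{\rm E}_p[l(X)]\bigr)p(k),$$ and suppose that for all $l\in\mathcal{H}$ this function exists and satisfies $f_l^{p,-}\in\mathcal{F}^{-}(p)\cap\mathcal{F}^{-}(q)$. Then $$d_{\mathcal{H}}(X,Y)\le\kappa_{\mathcal{H}}^{p,-}\sqrt{\mathcal{J}_{\rm gen}(X,Y)},$$ where $$\mathcal{J}_{\rm gen}(X,Y):={\rm E}_q\left[\left(\frac{q(Y-1)}{q(Y)}-\frac{p(Y-1)}{p(Y)}\right)^2\right]$$ and $$\kappa_{\mathcal{H}}^{p,-}:=\sup_{l\in\mathcal{H}}\sqrt{{\rm E}_q\left[\left(f_l^{p,-}(Y-1)\right)^2\right]}.$$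
   Context: $\mathcal{G}$ is the collection of probability mass functions $p:\mathbb{Z}\to[0,1]$ whose support $S_p:=\{x\in\mathbb{Z}:p(x)>0\}$ is a discrete interval $[a,b]:=\{a,a+1,\ldots,b\}$ with $a<b$, $a,b\in\mathbb{Z}\cup\{\pm\infty\}$ (infinite endpoints are not elements of the interval). Conventions: sums over empty index sets equal $0$, and $1/p(x)$ is understood to be $0$ when $x\notin S_p$ (for every $p\in\mathcal{G}$). For $p\in\mathcal{G}$, ${\rm E}_p[l(X)]=\sum_{x\in S_p}l(x)p(x)$ for $p$-summable $l$. Backward difference operator: $\Delta^{-}h(x)=h(x)-h(x-1)$ for $h:\mathbb{Z}\to\mathbb{R}$. For $p\in\mathcal{G}$ with support $[a,b]$, $\mathcal{F}^{-}(p)$ is the collection of functions $f:\mathbb{Z}\to\mathbb{R}$ such that $\sum_{j=a}^{b}\Delta^{-}(f(j)p(j))=0$ (meaning that $j\mapsto\Delta^{-}(f(j)p(j))$ is summable over $[a,b]$ with sum $0$). *)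

theory Defs
  imports "HOL-Probability.Probability" "HOL-Library.Extended"
begin

text \<open>Discrete intervals of integers whose endpoints are integers, \<open>Minf\<close> or \<open>Pinf\<close>; an
  infinite endpoint is not an element of the interval.\<close>

definition discrete_interval :: "int extended \<Rightarrow> int extended \<Rightarrow> int set" where
  "discrete_interval a b = {x. a \<le> Fin x \<and> Fin x \<le> b}"

definition pmf_class_G :: "int pmf set" where
  "pmf_class_G = {p. \<exists>a b. a < b \<and> set_pmf p = discrete_interval a b}"

definition backward_diff :: "(int \<Rightarrow> real) \<Rightarrow> int \<Rightarrow> real" where
  "backward_diff h x = h x - h (x - 1)"

definition stein_class_minus :: "int pmf \<Rightarrow> (int \<Rightarrow> real) set" where
  "stein_class_minus p =
     {f. ((\<lambda>j. backward_diff (\<lambda>i. f i * pmf p i) j) has_sum 0) (set_pmf p)}"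

text \<open>The function \<open>f\<^sub>l\<close> for a distribution whose support starts at 0. The convention that
  \<open>1 / p(x)\<close> is 0 outside the support of \<open>p\<close> is the library's \<open>1 / 0 = 0\<close>, and
  \<open>{0..x}\<close> is empty for negative \<open>x\<close>.\<close>

definition stein_solution_minus :: "int pmf \<Rightarrow> (int \<Rightarrow> real) \<Rightarrow> int \<Rightarrow> real" where
  "stein_solution_minus p l x =
     1 / pmf p x * (\<Sum>k\<in>{0..x}. (l k - measure_pmf.expectation p l) * pmf p k)"

text \<open>The suprema and second moments below may be infinite, so they take values in \<open>ennreal\<close>.\<close>

definition ennreal_sqrt :: "ennreal \<Rightarrow> ennreal" where
  "ennreal_sqrt x = (if x = top then top else ennreal (sqrt (enn2real x)))"

definition ipm_dist :: "(int \<Rightarrow> real) set \<Rightarrow> int pmf \<Rightarrow> int pmf \<Rightarrow> ennreal" where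
  "ipm_dist H p q =
     (SUP l\<in>H. ennreal \<bar>measure_pmf.expectation q l - measure_pmf.expectation p l\<bar>)"

definition J_gen :: "int pmf \<Rightarrow> int pmf \<Rightarrow> ennreal" where
  "J_gen p q =
     (\<integral>\<^sup>+ y. ennreal ((pmf q (y - 1) / pmf q y - pmf p (y - 1) / pmf p y)\<^sup>2) \<partial>measure_pmf q)"

definition kappa_minus :: "(int \<Rightarrow> real) set \<Rightarrow> int pmf \<Rightarrow> int pmf \<Rightarrow> ennreal" where
  "kappa_minus H p q =
     (SUP l\<in>H. ennreal_sqrt
        (\<integral>\<^sup>+ y. ennreal ((stein_solution_minus p l (y - 1))\<^sup>2) \<partial>measure_pmf q))"

end

theory Submission
  imports Defs
begin

text \<open>On the support of \<open>q\<close> the Stein solution \<open>f\<close> of \<open>l\<close> satisfies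
  \<open>l(y) - E\<^sub>p l = f(y) - f(y-1) p(y-1)/p(y)\<close>, while membership of \<open>f\<close> in the Stein class of \<open>q\<close>
  says that \<open>f(y) - f(y-1) q(y-1)/q(y)\<close> has mean zero under \<open>q\<close>. Subtracting,
  \<open>E\<^sub>q l - E\<^sub>p l\<close> is the \<open>q\<close>-mean of \<open>f(y-1) (q(y-1)/q(y) - p(y-1)/p(y))\<close>, and the
  Cauchy--Schwarz inequality gives the bound for each \<open>l\<close>.\<close>

text \<open>For real series \<open>has_sum\<close> is unconditional and therefore absolute
  convergence, which is integrability against the pmf. This turns membership in a Stein class into a
  statement about expectations.\<close>

lemma has_bochner_integral_measure_pmf_has_sum:
  fixes g :: "'a \<Rightarrow> real"
  assumes "((\<lambda>x. g x * pmf p x) has_sum s) (set_pmf p)"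
  shows "has_bochner_integral (measure_pmf p) g s"
proof -
  let ?h = "\<lambda>x. pmf p x * g x"
  have sum: "(?h has_sum s) UNIV"
    using assms by (subst has_sum_cong_neutral[where T = "set_pmf p" and g = "\<lambda>x. g x * pmf p x"])
      (auto simp: set_pmf_iff mult.commute)
  then have abs: "Infinite_Set_Sum.abs_summable_on ?h UNIV"
    unfolding abs_summable_equivalent[symmetric] summable_on_iff_abs_summable_on_real[symmetric]
    by (rule has_sum_imp_summable)
  then have "integrable (measure_pmf p) g"
    unfolding measure_pmf_eq_density
    by (subst integrable_density) (simp_all add: Infinite_Set_Sum.abs_summable_on_def)
  moreover have "measure_pmf.expectation p g = s"
    unfolding pmf_expectation_eq_infsetsum infsetsum_infsum[OF abs] by (rule infsumI[OF sum])
  ultimately show ?thesis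
    by (simp add: has_bochner_integral_iff)
qed

lemma ennreal_sqrt_mono: "x \<le> y \<Longrightarrow> ennreal_sqrt x \<le> ennreal_sqrt y"
  by (auto simp: ennreal_sqrt_def top_unique less_top intro!: ennreal_leI enn2real_mono)

lemma ennreal_sqrt_top [simp]: "ennreal_sqrt top = top"
  by (simp add: ennreal_sqrt_def)

lemma ennreal_sqrt_ennreal [simp]: "0 \<le> r \<Longrightarrow> ennreal_sqrt (ennreal r) = ennreal (sqrt r)"
  by (simp add: ennreal_sqrt_def)

lemma ennreal_sqrt_0 [simp]: "ennreal_sqrt 0 = 0"
  by (simp add: ennreal_sqrt_def)

lemma ennreal_sqrt_power2: "ennreal_sqrt (x\<^sup>2) = x"
  by (cases x) (simp_all add: ennreal_power)

lemma ennreal_sqrt_mult: "ennreal_sqrt (x * y) = ennreal_sqrt x * ennreal_sqrt y"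
proof (cases x; cases y)
  fix r s assume "0 \<le> r" "x = ennreal r" "0 \<le> s" "y = ennreal s"
  then show ?thesis
    by (simp add: real_sqrt_mult flip: ennreal_mult)
\<comment> \<open>If a factor is \<open>top\<close>, both sides are \<open>top\<close> or both are
  0, since 0 times \<open>top\<close> is 0 and the root of a finite value vanishes only at
  0.\<close>
qed (auto simp: ennreal_top_mult ennreal_mult_top)

text \<open>The bound lives in \<open>ennreal\<close> because either second moment may be infinite;
  integrability is asked of the product, whose mean is being estimated.\<close>

lemma Cauchy_Schwarz_lebesgue_nn:
  fixes f g :: "'a \<Rightarrow> real"
  assumes [measurable]: "f \<in> borel_measurable M" "g \<in> borel_measurable M"
    and int: "integrable M (\<lambda>x. f x * g x)"
  shows "ennreal \<bar>\<integral>x. f x * g x \<partial>M\<bar> \<le>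
    ennreal_sqrt (\<integral>\<^sup>+x. ennreal ((f x)\<^sup>2) \<partial>M) * ennreal_sqrt (\<integral>\<^sup>+x. ennreal ((g x)\<^sup>2) \<partial>M)"
proof -
  let ?I = "\<integral>\<^sup>+x. ennreal \<bar>f x\<bar> * ennreal \<bar>g x\<bar> \<partial>M"
  have "ennreal \<bar>\<integral>x. f x * g x \<partial>M\<bar> \<le> ?I"
    using integral_norm_bound_ennreal[OF int] by (simp add: abs_mult ennreal_mult)
  \<comment> \<open>\<open>Cauchy_Schwarz_nn_integral\<close> bounds the square of the integral, so
    the integral is first written as the root of its square.\<close>
  also have "?I = ennreal_sqrt (?I\<^sup>2)"
    by (simp only: ennreal_sqrt_power2)
  also have "\<dots> \<le> ennreal_sqrt ((\<integral>\<^sup>+x. (ennreal \<bar>f x\<bar>)\<^sup>2 \<partial>M) * (\<integral>\<^sup>+x. (ennreal \<bar>g x\<bar>)\<^sup>2 \<partial>M))"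
    by (intro ennreal_sqrt_mono Cauchy_Schwarz_nn_integral) auto
  finally show ?thesis
    by (simp add: ennreal_power ennreal_sqrt_mult)
qed

text \<open>Multiplied by p, the Stein solution is a partial sum, so two consecutive values differ
  by the single summand at y; dividing by p(y) > 0 gives the equation.\<close>

lemma stein_solution_minus_equation:
  assumes "set_pmf p = discrete_interval (Fin 0) M" and "y \<in> set_pmf p"
  shows "l y - measure_pmf.expectation p l =
    stein_solution_minus p l y - stein_solution_minus p l (y - 1) * (pmf p (y - 1) / pmf p y)"
proof -
  let ?t = "\<lambda>k. (l k - measure_pmf.expectation p l) * pmf p k"
  let ?f = "stein_solution_minus p l"
  have y: "0 \<le> y" "pmf p y \<noteq> 0"
    using assms by (auto simp: discrete_interval_def set_pmf_iff)
  \<comment> \<open>For y > 0 the interval also contains y - 1, so the factor 1/p(y-1) cancels. For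
    y = 0 the sum is empty and both sides are 0.\<close>
  have prev: "?f (y - 1) * pmf p (y - 1) = (\<Sum>k\<in>{0..y - 1}. ?t k)"
  proof (cases "y = 0")
    case False
    have "Fin (y - 1) \<le> Fin y" by simp
    also have "\<dots> \<le> M"
      using assms by (simp add: discrete_interval_def)
    finally have "y - 1 \<in> set_pmf p"
      using y False by (simp add: assms(1) discrete_interval_def)
    then show ?thesis
      by (simp add: stein_solution_minus_def set_pmf_iff)
  qed (simp add: stein_solution_minus_def)
  have "{0..y} = insert y {0..y - 1}"
    using y by auto
  then have "?f y * pmf p y = ?t y + (\<Sum>k\<in>{0..y - 1}. ?t k)"
    using y by (simp add: stein_solution_minus_def)
  with prev y show ?thesis
    by (simp add: field_simps)
qed

text \<open>\<open>has_bochner_integral\<close> records integrability of the product as well as its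
  mean; Cauchy--Schwarz needs both.\<close>

lemma expectation_diff_eq_stein:
  assumes p: "set_pmf p = discrete_interval (Fin 0) M"
    and sub: "set_pmf q \<subseteq> set_pmf p"
    and l: "integrable (measure_pmf q) l"
    and f: "stein_solution_minus p l \<in> stein_class_minus q"
  shows "has_bochner_integral (measure_pmf q)
    (\<lambda>y. stein_solution_minus p l (y - 1) * (pmf q (y - 1) / pmf q y - pmf p (y - 1) / pmf p y))
    (measure_pmf.expectation q l - measure_pmf.expectation p l)"
proof -
  let ?f = "stein_solution_minus p l"
  let ?E = "measure_pmf.expectation p l"
  let ?g = "\<lambda>y. ?f y - ?f (y - 1) * (pmf q (y - 1) / pmf q y)"
  \<comment> \<open>On the support of q, where q(y) can be divided out, ?g(y) q(y) is the backward
    difference of the product of ?f and q.\<close>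
  have "((\<lambda>y. ?g y * pmf q y) has_sum 0) (set_pmf q)"
    using f unfolding stein_class_minus_def mem_Collect_eq
    by (rule has_sum_cong[THEN iffD1, rotated])
      (simp add: backward_diff_def set_pmf_iff field_simps)
  then have g: "has_bochner_integral (measure_pmf q) ?g 0"
    by (rule has_bochner_integral_measure_pmf_has_sum)
  have "has_bochner_integral (measure_pmf q) (\<lambda>y. l y - ?E)
      (measure_pmf.expectation q l - ?E)"
    using l by (simp add: has_bochner_integral_iff)
  from has_bochner_integral_diff[OF this g]
  have h: "has_bochner_integral (measure_pmf q) (\<lambda>y. (l y - ?E) - ?g y)
      (measure_pmf.expectation q l - ?E)"
    by simp
  \<comment> \<open>The terms ?f(y) cancel. The Stein equation for p is available q-almost
    everywhere because the support of q lies in that of p.\<close>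
  have "AE y in measure_pmf q. (l y - ?E) - ?g y =
      ?f (y - 1) * (pmf q (y - 1) / pmf q y - pmf p (y - 1) / pmf p y)"
    using stein_solution_minus_equation[OF p, of _ l] sub
    by (auto simp: AE_measure_pmf_iff algebra_simps)
  from has_bochner_integral_cong_AE[OF _ _ this] h show ?thesis
    by simp
qed

theorem theorem3p1:
  fixes p q :: "int pmf" and M N :: "int extended" and H :: "(int \<Rightarrow> real) set"
  assumes "p \<in> pmf_class_G" and "q \<in> pmf_class_G"
    and "set_pmf p = discrete_interval (Fin 0) M"
    and "set_pmf q = discrete_interval (Fin 0) N"
    and "Fin 0 \<le> N" and "N \<le> M"
    and "stein_class_minus p \<inter> stein_class_minus q \<noteq> {}"
    and "\<And>l. l \<in> H \<Longrightarrow> integrable (measure_pmf p) l"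
    and "\<And>l. l \<in> H \<Longrightarrow> integrable (measure_pmf q) l"
    and "\<And>l. l \<in> H \<Longrightarrow> stein_solution_minus p l \<in> stein_class_minus p \<inter> stein_class_minus q"
  shows "ipm_dist H p q \<le> kappa_minus H p q * ennreal_sqrt (J_gen p q)"
proof -
  have sub: "set_pmf q \<subseteq> set_pmf p"
    using \<open>N \<le> M\<close> unfolding assms(3,4) discrete_interval_def by (auto intro: order_trans)
  show ?thesis
    unfolding ipm_dist_def
  proof (rule SUP_least)
    fix l assume l: "l \<in> H"
    let ?f = "stein_solution_minus p l"
    have eq: "has_bochner_integral (measure_pmf q)
        (\<lambda>y. ?f (y - 1) * (pmf q (y - 1) / pmf q y - pmf p (y - 1) / pmf p y))
        (measure_pmf.expectation q l - measure_pmf.expectation p l)"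
      using assms(9,10)[OF l] by (intro expectation_diff_eq_stein[OF assms(3) sub]) auto
    have "ennreal \<bar>measure_pmf.expectation q l - measure_pmf.expectation p l\<bar>
        \<le> ennreal_sqrt (\<integral>\<^sup>+ y. ennreal ((?f (y - 1))\<^sup>2) \<partial>measure_pmf q) * ennreal_sqrt (J_gen p q)"
      using Cauchy_Schwarz_lebesgue_nn[OF _ _ has_bochner_integral_iff[THEN iffD1, OF eq, THEN conjunct1]]
      by (simp add: J_gen_def has_bochner_integral_integral_eq[OF eq])
    also have "\<dots> \<le> kappa_minus H p q * ennreal_sqrt (J_gen p q)"
      \<comment> \<open>The factor with the shifted Stein solution is the member of the supremum
        indexed by this l.\<close>
      unfolding kappa_minus_def using l by (intro mult_right_mono SUP_upper) auto
    finally show "ennreal \<bar>measure_pmf.expectation q l - measure_pmf.expectation p l\<bar>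
        \<le> kappa_minus H p q * ennreal_sqrt (J_gen p q)" .
  qed
qed

end
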